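(* Let $M$ be a nonempty set, let $\le$ be a quasi-order on $M$ such that $(M,\le)$ is sequentially inductive, and let $\Phi=(\varphi_i;\, i\ge 0)$ be a sequence of functions $\varphi_i:M\to \mathbb{R}\cup\{-\infty,\infty\}$, each of which is $(\le)$-decreasing. Suppose that, for some $j\in\{1,2,3,4,5,6\}$, all the functions $\varphi_i$ ($i\ge 0$) belong to the subclass (P$j$). Then: (i) $\max(M;\le;\Phi)$ is $(\le)$-cofinal in $M$: for each $u\in M$ there exists $v\in\max(M;\le;\Phi)$ with $u\le v$; (ii) $\max(M;\le;\Phi)$ is $(\le)$-invariant in $M$: if $u\in\max(M;\le;\Phi)$, $v\in M$ and $u\le v$, then $v\in\max(M;\le;\Phi)$.
   Context: A quasi-order is a reflexive and transitive relation. $(M,\le)$ is sequentially inductive if each ascending sequence $(x_n)$ in $M$ (i.e. $x_n\le x_m$ whenever $n\le m$) has an upper bound in $M$ modulo $\le$. A function $\varphi:M\to\mathbb{R}\cup\{-\infty,\infty\}$ is $(\le)$-decreasing if $x_1\le x_2$ implies $\varphi(x_1)\ge\varphi(x_2)$. A point $z\in M$ is $(\le,\varphi)$-maximal if $z\le w\in M$ implies $\varphi(z)=\varphi(w)$; the set of these points is $\max(M;\le;\varphi)$. For a sequence $\Phi=(\varphi_i;\,i\ge0)$, $\max(M;\le;\Phi)=\bigcap_{i\ge 0}\max(M;\le;\varphi_i)$. Subclasses of functions $\varphi:M\to\mathbb{R}\cup\{-\infty,\infty\}$: (P1) $\varphi(M)\subseteq\mathbb{R}$ and $\varphi$ is bounded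 ($-\infty<\inf\varphi(M)\le\sup\varphi(M)<\infty$); (P2) the general case (no restriction; the values $\pm\infty$ are allowed); (P3) $\varphi(M)\subseteq\mathbb{R}\cup\{\infty\}$ and $\inf\varphi(M)>-\infty$; (P4) $\varphi(M)\subseteq\mathbb{R}\cup\{\infty\}$ and $\inf\varphi(M)\ge 0$; (P5) $\varphi(M)\subseteq\mathbb{R}$ and $\inf\varphi(M)>-\infty$; (P6) $\varphi(M)\subseteq\mathbb{R}$ and $\inf\varphi(M)\ge 0$. The result is understood in Zermelo-Fraenkel set theory without the Axiom of Choice, augmented by the Principle of Dependent Choices. *)

theory Defs
  imports Complex_Main "HOL-Library.Extended_Real"
begin

text \<open>
  The carrier is a set \<open>M\<close>; the order and the functions live on the ambient type,
  but every notion below only looks at their values on \<open>M\<close>.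
\<close>

definition quasi_order_on :: "'a set \<Rightarrow> ('a \<Rightarrow> 'a \<Rightarrow> bool) \<Rightarrow> bool" where
  "quasi_order_on M le \<longleftrightarrow> reflp_on M le \<and> transp_on M le"

definition sequentially_inductive :: "'a set \<Rightarrow> ('a \<Rightarrow> 'a \<Rightarrow> bool) \<Rightarrow> bool" where
  "sequentially_inductive M le \<longleftrightarrow>
     (\<forall>x :: nat \<Rightarrow> 'a. (\<forall>n. x n \<in> M) \<and> (\<forall>n m. n \<le> m \<longrightarrow> le (x n) (x m)) \<longrightarrow>
        (\<exists>y\<in>M. \<forall>n. le (x n) y))"

definition decreasing_on :: "'a set \<Rightarrow> ('a \<Rightarrow> 'a \<Rightarrow> bool) \<Rightarrow> ('a \<Rightarrow> ereal) \<Rightarrow> bool" where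
  "decreasing_on M le \<phi> \<longleftrightarrow> monotone_on M le (\<ge>) \<phi>"

definition max_points :: "'a set \<Rightarrow> ('a \<Rightarrow> 'a \<Rightarrow> bool) \<Rightarrow> ('a \<Rightarrow> ereal) \<Rightarrow> 'a set" where
  "max_points M le \<phi> = {z \<in> M. \<forall>w\<in>M. le z w \<longrightarrow> \<phi> z = \<phi> w}"

definition max_points_seq ::
    "'a set \<Rightarrow> ('a \<Rightarrow> 'a \<Rightarrow> bool) \<Rightarrow> (nat \<Rightarrow> 'a \<Rightarrow> ereal) \<Rightarrow> 'a set" where
  "max_points_seq M le \<Phi> = (\<Inter>i. max_points M le (\<Phi> i))"

definition cofinal_in :: "'a set \<Rightarrow> ('a \<Rightarrow> 'a \<Rightarrow> bool) \<Rightarrow> 'a set \<Rightarrow> bool" where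
  "cofinal_in M le N \<longleftrightarrow> (\<forall>u\<in>M. \<exists>v\<in>N. le u v)"

definition invariant_in :: "'a set \<Rightarrow> ('a \<Rightarrow> 'a \<Rightarrow> bool) \<Rightarrow> 'a set \<Rightarrow> bool" where
  "invariant_in M le N \<longleftrightarrow> (\<forall>u\<in>N. \<forall>v\<in>M. le u v \<longrightarrow> v \<in> N)"

text \<open>
  The subclasses (P1)--(P6). The real line inside \<^typ>\<open>ereal\<close> is \<open>range ereal\<close>,
  and \<open>INF\<close>, \<open>SUP\<close> are taken in the complete lattice \<^typ>\<open>ereal\<close>.
\<close>

definition P1 :: "'a set \<Rightarrow> ('a \<Rightarrow> ereal) \<Rightarrow> bool" where
  "P1 M \<phi> \<longleftrightarrow> \<phi> ` M \<subseteq> range ereal \<and> - \<infinity> < (INF x\<in>M. \<phi> x) \<and> (SUP x\<in>M. \<phi> x) < \<infinity>"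

definition P2 :: "'a set \<Rightarrow> ('a \<Rightarrow> ereal) \<Rightarrow> bool" where
  "P2 M \<phi> \<longleftrightarrow> True"

definition P3 :: "'a set \<Rightarrow> ('a \<Rightarrow> ereal) \<Rightarrow> bool" where
  "P3 M \<phi> \<longleftrightarrow> \<phi> ` M \<subseteq> range ereal \<union> {\<infinity>} \<and> - \<infinity> < (INF x\<in>M. \<phi> x)"

definition P4 :: "'a set \<Rightarrow> ('a \<Rightarrow> ereal) \<Rightarrow> bool" where
  "P4 M \<phi> \<longleftrightarrow> \<phi> ` M \<subseteq> range ereal \<union> {\<infinity>} \<and> 0 \<le> (INF x\<in>M. \<phi> x)"

definition P5 :: "'a set \<Rightarrow> ('a \<Rightarrow> ereal) \<Rightarrow> bool" where
  "P5 M \<phi> \<longleftrightarrow> \<phi> ` M \<subseteq> range ereal \<and> - \<infinity> < (INF x\<in>M. \<phi> x)"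

definition P6 :: "'a set \<Rightarrow> ('a \<Rightarrow> ereal) \<Rightarrow> bool" where
  "P6 M \<phi> \<longleftrightarrow> \<phi> ` M \<subseteq> range ereal \<and> 0 \<le> (INF x\<in>M. \<phi> x)"

end

theory Submission
  imports Defs
begin

text \<open>
  A point \<open>v\<close> fails to be maximal for a decreasing \<open>\<phi>\<close> exactly when some \<open>w\<close> above \<open>v\<close> has
  \<open>\<phi> w < \<phi> v\<close>, and then a rational \<open>q\<close> lies strictly between the two values. So maximality
  for all \<open>\<Phi> i\<close> amounts to countably many conditions, one for each pair \<open>(i, q)\<close>: if the
  sublevel set \<open>{x. \<Phi> i x < q}\<close> can be entered from \<open>v\<close> by going up, then \<open>v\<close> is already in it.

  These sublevel sets are upward closed because \<open>\<Phi> i\<close> decreases. Starting at \<open>u\<close>, run through the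
  pairs one after the other, each time moving up into the corresponding set if this is
  possible and staying in place otherwise. An upper bound \<open>v\<close> of the resulting
  ascending sequence decides every condition: a set that can be entered from \<open>v\<close> could also be
  entered at its turn, hence was entered, and \<open>v\<close> is still in it. This is
  \<open>countably_many_upsets_decided_above\<close>. The sequence is where dependent
  choice enters. Of the extended reals the argument uses only that the rationals are order-dense
  in them, infinite values included, so it treats the six subclasses at once.

  Invariance is transitivity: if \<open>v\<close> lies above a maximal \<open>u\<close>, then so does everything above
  \<open>v\<close>, and all the values in question equal the one at \<open>u\<close>.
\<close>

lemma ascending_if_steps:
  assumes qo: "quasi_order_on M le" and M: "\<And>n. x n \<in> M"
    and step: "\<And>n. le (x n) (x (Suc n))" and "n \<le> m"
  shows "le (x n) (x m)"
  using \<open>n \<le> m\<close>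
proof (induction rule: dec_induct)
  case base
  show ?case using qo M unfolding quasi_order_on_def by (auto dest: reflp_onD)
next
  case (step k)
  then show ?case
    using qo M assms(3) unfolding quasi_order_on_def by (meson transp_onD)
qed

text \<open>
  The Brezis--Browder principle with the functions abstracted away. A single visit to each \<open>U n\<close>
  suffices because it is upward closed: membership gained at step \<open>n\<close> passes to the bound.
\<close>

lemma countably_many_upsets_decided_above:
  fixes U :: "nat \<Rightarrow> 'a set"
  assumes qo: "quasi_order_on M le" and ind: "sequentially_inductive M le"
    and up: "\<And>n x y. x \<in> M \<Longrightarrow> y \<in> M \<Longrightarrow> x \<in> U n \<Longrightarrow> le x y \<Longrightarrow> y \<in> U n"
    and u: "u \<in> M"
  shows "\<exists>v\<in>M. le u v \<and> (\<forall>n. \<forall>w\<in>M. le v w \<longrightarrow> w \<in> U n \<longrightarrow> v \<in> U n)"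
proof -
  have refl: "le a a" if "a \<in> M" for a
    using qo that unfolding quasi_order_on_def by (auto dest: reflp_onD)
  have trans: "le a c" if "le a b" "le b c" "a \<in> M" "b \<in> M" "c \<in> M" for a b c
    using qo that unfolding quasi_order_on_def by (meson transp_onD)
  let ?R = "\<lambda>n a b. le a b \<and> ((\<exists>w\<in>M. le a w \<and> w \<in> U n) \<longrightarrow> b \<in> U n)"
  have "\<exists>b. b \<in> M \<and> ?R n a b" if "a \<in> M" for a n
    using refl that by blast
  then have "\<exists>x. \<forall>n. (x n \<in> M \<and> (n = 0 \<longrightarrow> x n = u)) \<and> ?R n (x n) (x (Suc n))"
    using u by (intro dependent_nat_choice) auto
  then obtain x where x: "\<And>n. x n \<in> M" "x 0 = u" "\<And>n. ?R n (x n) (x (Suc n))"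
    by metis
  have "\<forall>n m. n \<le> m \<longrightarrow> le (x n) (x m)"
    using ascending_if_steps[OF qo] x by blast
  then obtain v where v: "v \<in> M" "\<And>n. le (x n) v"
    using ind x(1) unfolding sequentially_inductive_def by blast
  have "v \<in> U n" if "w \<in> M" "le v w" "w \<in> U n" for n w
  proof -
    have "le (x n) w" using trans v x(1) that by blast
    then have "x (Suc n) \<in> U n" using x(3) that by blast
    then show ?thesis using up v x(1) by blast
  qed
  moreover have "le u v" using v(2)[of 0] x(2) by simp
  ultimately show ?thesis using v(1) by blast
qed

lemma max_points_seq_cofinal:
  fixes \<Phi> :: "nat \<Rightarrow> 'a \<Rightarrow> ereal"
  assumes qo: "quasi_order_on M le" and ind: "sequentially_inductive M le"
    and dec: "\<And>i. decreasing_on M le (\<Phi> i)"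
  shows "cofinal_in M le (max_points_seq M le \<Phi>)"
  unfolding cofinal_in_def
proof
  fix u assume u: "u \<in> M"
  have anti: "\<Phi> i b \<le> \<Phi> i a" if "a \<in> M" "b \<in> M" "le a b" for i a b
    using dec[of i] that unfolding decreasing_on_def by (meson monotone_onD)
  define S where "S = (\<lambda>(i, q::rat). {x. \<Phi> i x < ereal (real_of_rat q)})"
  define U where "U = (\<lambda>n. S (from_nat n))"
  have up: "y \<in> U n" if "x \<in> M" "y \<in> M" "x \<in> U n" "le x y" for n x y
    using that(3) anti[OF that(1,2,4)] unfolding U_def S_def
    by (auto split: prod.splits intro: le_less_trans)
  have "\<exists>v\<in>M. le u v \<and> (\<forall>n. \<forall>w\<in>M. le v w \<longrightarrow> w \<in> U n \<longrightarrow> v \<in> U n)"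
    using qo ind up u by (rule countably_many_upsets_decided_above)
  then obtain v where v: "v \<in> M" "le u v"
    "\<And>n w. w \<in> M \<Longrightarrow> le v w \<Longrightarrow> w \<in> U n \<Longrightarrow> v \<in> U n"
    by blast
  have "\<Phi> i v = \<Phi> i w" if w: "w \<in> M" "le v w" for i w
  proof (rule ccontr)
    assume "\<Phi> i v \<noteq> \<Phi> i w"
    then have "\<Phi> i w < \<Phi> i v" using anti[OF v(1) w] by (simp add: less_le)
    then obtain q :: rat where q: "\<Phi> i w < real_of_rat q" "real_of_rat q < \<Phi> i v"
      using ereal_dense3 by blast
    then have "w \<in> U (to_nat (i, q))" by (simp add: U_def S_def)
    then have "v \<in> U (to_nat (i, q))" using v(3) w by blast
    then show False using q(2) by (simp add: U_def S_def)
  qed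
  then show "\<exists>v\<in>max_points_seq M le \<Phi>. le u v"
    using v(1,2) unfolding max_points_seq_def max_points_def by blast
qed

lemma max_points_seq_invariant:
  assumes qo: "quasi_order_on M le"
  shows "invariant_in M le (max_points_seq M le \<Phi>)"
proof -
  have trans: "le a c" if "le a b" "le b c" "a \<in> M" "b \<in> M" "c \<in> M" for a b c
    using qo that unfolding quasi_order_on_def by (meson transp_onD)
  have "v \<in> max_points M le \<phi>" if "u \<in> max_points M le \<phi>" "v \<in> M" "le u v"
    for u v and \<phi> :: "'a \<Rightarrow> ereal"
  proof -
    have "u \<in> M" and const: "\<And>w. w \<in> M \<Longrightarrow> le u w \<Longrightarrow> \<phi> u = \<phi> w"
      using that(1) unfolding max_points_def by auto
    then have "\<phi> v = \<phi> w" if "w \<in> M" "le v w" for w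
      using trans[OF \<open>le u v\<close>] that \<open>v \<in> M\<close> \<open>le u v\<close> by metis
    then show ?thesis using \<open>v \<in> M\<close> unfolding max_points_def by blast
  qed
  then show ?thesis
    unfolding invariant_in_def max_points_seq_def by blast
qed

theorem theorem3:
  fixes M :: "'a set" and le :: "'a \<Rightarrow> 'a \<Rightarrow> bool" and \<Phi> :: "nat \<Rightarrow> 'a \<Rightarrow> ereal"
  assumes "M \<noteq> {}"
    and "quasi_order_on M le"
    and "sequentially_inductive M le"
    and "\<And>i. decreasing_on M le (\<Phi> i)"
    and "\<exists>P \<in> {P1, P2, P3, P4, P5, P6}. \<forall>i. P M (\<Phi> i)"
  shows "cofinal_in M le (max_points_seq M le \<Phi>) \<and>
         invariant_in M le (max_points_seq M le \<Phi>)"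
  using max_points_seq_cofinal[where \<Phi> = \<Phi>, OF assms(2-4)] max_points_seq_invariant[OF assms(2)] by blast

end
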